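(* For the three-dimensional BiHom-Lie algebra $\mathcal{L}_2$ over $\mathbb{C}$, and for the three-dimensional BiHom-Lie algebra $\mathcal{L}_3$ over $\mathbb{C}$ with any parameter $a\in\mathbb{C}$ (both described in the context), the moduli space of Nijenhuis operators is $\mathbb{C}^2$.
   Context: A BiHom-Lie algebra is a 4-tuple $(L,[\cdot,\cdot],\alpha,\beta)$ with $L$ a vector space over $\mathbb{C}$, $[\cdot,\cdot]:L\times L\to L$ bilinear, $\alpha,\beta:L\to L$ linear, such that for all $x,y,z\in L$: (i) $\alpha\circ\beta=\beta\circ\alpha$; (ii) $\alpha([x,y])=[\alpha(x),\alpha(y)]$ and $\beta([x,y])=[\beta(x),\beta(y)]$; (iii) $[\beta(x),\alpha(y)]=-[\beta(y),\alpha(x)]$; (iv) $[\beta^2(x),[\beta(y),\alpha(z)]]+[\beta^2(y),[\beta(z),\alpha(x)]]+[\beta^2(z),[\beta(x),\alpha(y)]]=0$. A linear map $N:L\to L$ is a Nijenhuis operator on it if $N\circ\alpha=\alpha\circ N$, $N\circ\beta=\beta\circ N$, and $[N(x),N(y)]=N([N(x),y]+[x,N(y)]-N[x,y])$ for all $x,y\in L$. An automorphism is a bijective linear map preserving the bracket and commuting with $\alpha$ and $\beta$. The moduli space of Nijenhuis operators is the set of all Nijenhuis operators modulo conjugation $N\mapsto\phi N\phi^{-1}$ by automorphisms $\phi$. Matrices act by columns: $(m_{ij})$ represents $e_j\mapsto\sum_i m_{ij}e_i$. $\mathcal{L}_2$ has basis $\{e_1,e_2,e_3\}$, $\alpha_2=\mathrm{id}$,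 $\beta_2=\begin{pmatrix}1&1&0\\0&1&1\\0&0&1\end{pmatrix}$, and brackets $[e_1,e_1]=0$, $[e_1,e_2]=2e_1$, $[e_1,e_3]=e_1+2e_2$, $[e_2,e_1]=-2e_1$, $[e_2,e_2]=-2e_1$, $[e_2,e_3]=e_1+e_2+2e_3$, $[e_3,e_1]=e_1-2e_2$, $[e_3,e_2]=-3e_2-2e_3$, $[e_3,e_3]=-e_1-e_2-2e_3$. $\mathcal{L}_3$ ($a\in\mathbb{C}$) has basis $\{e_1,e_2,e_3\}$, $\alpha_3=\begin{pmatrix}1&1&0\\0&1&1\\0&0&1\end{pmatrix}$, $\beta_3=\begin{pmatrix}1&a&\frac{a^2-a}{2}\\0&1&a\\0&0&1\end{pmatrix}$, and brackets $[e_1,e_1]=0$, $[e_1,e_2]=2e_1$, $[e_1,e_3]=(2a-1)e_1+2e_2$, $[e_2,e_1]=-2e_1$, $[e_2,e_2]=2(1-a)e_1$, $[e_2,e_3]=\frac{3a-a^2}{2}e_1+3e_2+2e_3$, $[e_3,e_1]=-e_1-2e_2$, $[e_3,e_2]=-(a+1)e_1-(1+2a)e_2-2e_3$, $[e_3,e_3]=\frac{(1-a)(a+4)}{2}e_1+(1-a^2)e_2+2(1-a)e_3$.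
   Formalization: As printed, L_3 violates BiHom axiom (iii) for every a. The claim is proved for the printed brackets, and also, with the BiHom-Lie axioms, for a corrected L_3 whose e_1-coefficients are 3a-a^2 in [e_2,e_3] and (1-a)(a+2)/2 in [e_3,e_3]. *)

theory Defs
  imports "HOL-Analysis.Analysis"
begin

section \<open>BiHom-Lie algebras on complex coordinate spaces\<close>

abbreviation clinear :: "(complex^'n \<Rightarrow> complex^'m) \<Rightarrow> bool" where
  "clinear \<equiv> Vector_Spaces.linear (*s) (*s)"

text \<open>The data of a BiHom-Lie algebra; the axioms are imposed by \<open>bihom_lie_algebra\<close> below.
  Nijenhuis operators, automorphisms and moduli are defined for arbitrary data, because one of the
  multiplication tables below violates the axioms (see the remark at \<open>L3\<close>).\<close>

record 'n bihom =
  br :: "complex^'n \<Rightarrow> complex^'n \<Rightarrow> complex^'n"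
  twa :: "complex^'n \<Rightarrow> complex^'n"
  twb :: "complex^'n \<Rightarrow> complex^'n"

definition bihom_lie_algebra :: "'n::finite bihom \<Rightarrow> bool" where
  "bihom_lie_algebra L \<longleftrightarrow>
     (\<forall>x. clinear (br L x)) \<and> (\<forall>y. clinear (\<lambda>x. br L x y)) \<and>
     clinear (twa L) \<and> clinear (twb L) \<and>
     twa L \<circ> twb L = twb L \<circ> twa L \<and>
     (\<forall>x y. twa L (br L x y) = br L (twa L x) (twa L y)) \<and>
     (\<forall>x y. twb L (br L x y) = br L (twb L x) (twb L y)) \<and>
     (\<forall>x y. br L (twb L x) (twa L y) = - br L (twb L y) (twa L x)) \<and>
     (\<forall>x y z. br L (twb L (twb L x)) (br L (twb L y) (twa L z))
            + br L (twb L (twb L y)) (br L (twb L z) (twa L x))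
            + br L (twb L (twb L z)) (br L (twb L x) (twa L y)) = 0)"

definition nijenhuis :: "'n::finite bihom \<Rightarrow> (complex^'n \<Rightarrow> complex^'n) set" where
  "nijenhuis L = {N. clinear N \<and> N \<circ> twa L = twa L \<circ> N \<and> N \<circ> twb L = twb L \<circ> N \<and>
     (\<forall>x y. br L (N x) (N y) = N (br L (N x) y + br L x (N y) - N (br L x y)))}"

definition automorphisms :: "'n::finite bihom \<Rightarrow> (complex^'n \<Rightarrow> complex^'n) set" where
  "automorphisms L = {\<phi>. clinear \<phi> \<and> bij \<phi> \<and> \<phi> \<circ> twa L = twa L \<circ> \<phi> \<and> \<phi> \<circ> twb L = twb L \<circ> \<phi> \<and>
     (\<forall>x y. \<phi> (br L x y) = br L (\<phi> x) (\<phi> y))}"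

definition conjugacy ::
  "'n::finite bihom \<Rightarrow> ((complex^'n \<Rightarrow> complex^'n) \<times> (complex^'n \<Rightarrow> complex^'n)) set" where
  "conjugacy L = {(N, N'). N \<in> nijenhuis L \<and> N' \<in> nijenhuis L \<and>
     (\<exists>\<phi>\<in>automorphisms L. N' = \<phi> \<circ> N \<circ> inv \<phi>)}"

definition moduli_space :: "'n::finite bihom \<Rightarrow> (complex^'n \<Rightarrow> complex^'n) set set" where
  "moduli_space L = nijenhuis L // conjugacy L"


section \<open>Identifying a moduli space with an affine space\<close>

text \<open>Polynomial functions in a given set of complex-valued coordinate functions.\<close>

inductive polynomial_in :: "('v \<Rightarrow> complex) set \<Rightarrow> ('v \<Rightarrow> complex) \<Rightarrow> bool" for X where
  const: "polynomial_in X (\<lambda>_. c)"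
| coord: "f \<in> X \<Longrightarrow> polynomial_in X f"
| add: "polynomial_in X f \<Longrightarrow> polynomial_in X g \<Longrightarrow> polynomial_in X (\<lambda>v. f v + g v)"
| mult: "polynomial_in X f \<Longrightarrow> polynomial_in X g \<Longrightarrow> polynomial_in X (\<lambda>v. f v * g v)"

definition vector_coords :: "(complex^'k \<Rightarrow> complex) set" where
  "vector_coords = {\<lambda>p. p $ i | i. True}"

definition operator_coords :: "((complex^'n \<Rightarrow> complex^'n) \<Rightarrow> complex) set" where
  "operator_coords = {\<lambda>N. matrix N $ i $ j | i j. True}"

text \<open>A bare bijection between the moduli space and \<open>\<complex>\<^sup>k\<close> would only compare cardinalities and
  could not tell \<open>\<complex>\<^sup>2\<close> from \<open>\<complex>\<close>.  We ask for a bijection that is polynomial in both directions: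
  the composite with the quotient map is the restriction of a polynomial map in the matrix entries,
  and the inverse lifts to a polynomial family of Nijenhuis operators.  In particular the bijection
  is a homeomorphism for the quotient topology, and it determines \<open>k\<close>.\<close>

definition moduli_identification ::
  "'n::finite bihom \<Rightarrow> ((complex^'n \<Rightarrow> complex^'n) set \<Rightarrow> complex^'k) \<Rightarrow> bool" where
  "moduli_identification L \<Phi> \<longleftrightarrow>
     bij_betw \<Phi> (moduli_space L) UNIV \<and>
     (\<forall>k. \<exists>f. polynomial_in operator_coords f \<and>
        (\<forall>N\<in>nijenhuis L. \<Phi> (conjugacy L `` {N}) $ k = f N)) \<and>
     (\<exists>\<sigma>. (\<forall>i j. polynomial_in vector_coords (\<lambda>p. matrix (\<sigma> p) $ i $ j)) \<and>
        (\<forall>p. \<sigma> p \<in> nijenhuis L \<and> \<Phi> (conjugacy L `` {\<sigma> p}) = p))"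


section \<open>The algebras\<close>

text \<open>\<open>c $ i $ j\<close> is the bracket of the \<open>i\<close>-th and the \<open>j\<close>-th basis vector.\<close>

definition bracket_of :: "complex^3^3^3 \<Rightarrow> complex^3 \<Rightarrow> complex^3 \<Rightarrow> complex^3" where
  "bracket_of c x y = (\<Sum>i\<in>UNIV. \<Sum>j\<in>UNIV. (x $ i * y $ j) *s (c $ i $ j))"

definition mat3 :: "complex list list \<Rightarrow> complex^3^3" where
  "mat3 m = vector (map vector m)"

definition table3 :: "complex list list list \<Rightarrow> complex^3^3^3" where
  "table3 c = vector (map mat3 c)"

definition L2 :: "3 bihom" where
  "L2 = \<lparr>
     br = bracket_of (table3
       [[[0, 0, 0],   [2, 0, 0],   [1, 2, 0]],
        [[-2, 0, 0],  [-2, 0, 0],  [1, 1, 2]],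
        [[1, -2, 0],  [0, -3, -2], [-1, -1, -2]]]),
     twa = id,
     twb = (*v) (mat3 [[1, 1, 0], [0, 1, 1], [0, 0, 1]]) \<rparr>"

definition L3_data :: "complex \<Rightarrow> complex^3^3^3 \<Rightarrow> 3 bihom" where
  "L3_data a c = \<lparr>
     br = bracket_of c,
     twa = (*v) (mat3 [[1, 1, 0], [0, 1, 1], [0, 0, 1]]),
     twb = (*v) (mat3 [[1, a, (a^2 - a) / 2], [0, 1, a], [0, 0, 1]]) \<rparr>"

text \<open>\<open>L3\<close> is the multiplication table exactly as printed in the source.  It is misprinted: for
  no value of \<open>a\<close> does it satisfy \<open>[\<beta> x, \<alpha> y] = - [\<beta> y, \<alpha> x]\<close>.  \<open>L3_corrected\<close> changes the
  \<open>e\<^sub>1\<close>-coefficient of \<open>[e\<^sub>2, e\<^sub>3]\<close> from \<open>(3a - a\<^sup>2)/2\<close> to \<open>3a - a\<^sup>2\<close> and that of \<open>[e\<^sub>3, e\<^sub>3]\<close> from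
  \<open>(1 - a)(a + 4)/2\<close> to \<open>(1 - a)(a + 2)/2\<close>.  It is the twist \<open>[x, y] = {\<alpha> x, \<beta> y}\<close> of the Lie
  bracket \<open>{e\<^sub>1, e\<^sub>2} = 2e\<^sub>1\<close>, \<open>{e\<^sub>1, e\<^sub>3} = -e\<^sub>1 + 2e\<^sub>2\<close>, \<open>{e\<^sub>2, e\<^sub>3} = e\<^sub>1 + e\<^sub>2 + 2e\<^sub>3\<close>, of which \<open>L2\<close> is
  the twist by its own \<open>\<alpha>\<close> and \<open>\<beta>\<close>.\<close>

definition L3 :: "complex \<Rightarrow> 3 bihom" where
  "L3 a = L3_data a (table3
     [[[0, 0, 0],  [2, 0, 0],  [2*a - 1, 2, 0]],
      [[-2, 0, 0], [2*(1 - a), 0, 0],  [(3*a - a^2) / 2, 3, 2]],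
      [[-1, -2, 0], [-(a + 1), -(1 + 2*a), -2],
         [(1 - a)*(a + 4) / 2, 1 - a^2, 2*(1 - a)]]])"

definition L3_corrected :: "complex \<Rightarrow> 3 bihom" where
  "L3_corrected a = L3_data a (table3
     [[[0, 0, 0],  [2, 0, 0],  [2*a - 1, 2, 0]],
      [[-2, 0, 0], [2*(1 - a), 0, 0],  [3*a - a^2, 3, 2]],
      [[-1, -2, 0], [-(a + 1), -(1 + 2*a), -2],
         [(1 - a)*(a + 2) / 2, 1 - a^2, 2*(1 - a)]]])"

end

theory Submission
  imports Defs
begin

text \<open>
  In each of the three families the twisting maps are upper triangular Toeplitz matrices, and at
  least one of them is a full unipotent Jordan block.  Everything that commutes with a full Jordan
  block is a polynomial \<open>x + y E + z E\<^sup>2\<close> in its nilpotent part \<open>E\<close>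
  (\<open>commutes_with_unipotent_one\<close>).  This applies to Nijenhuis operators and to automorphisms, so
  the two commute with each other, conjugation acts trivially, and the moduli space is the set of
  Nijenhuis operators itself (\<open>conjugacy_trivial\<close>).

  It remains to see which \<open>x + y E + z E\<^sup>2\<close> are Nijenhuis.  The Nijenhuis identity is insensitive to
  adding scalars.  Evaluated at \<open>(e\<^sub>2, e\<^sub>3)\<close>, its \<open>e\<^sub>1\<close>-component reads \<open>2 y\<^sup>2 = 0\<close>, which forces
  \<open>y = 0\<close>.  Conversely \<open>M = z E\<^sup>2\<close> has rank at most one, with image in the span of \<open>e\<^sub>1\<close> and kernel
  containing \<open>e\<^sub>1\<close> and \<open>e\<^sub>2\<close>; since \<open>[e\<^sub>1, e\<^sub>1] = 0\<close> and since brackets with \<open>e\<^sub>1\<close> have no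
  \<open>e\<^sub>3\<close>-component, both sides of the identity for \<open>M\<close> vanish.  Hence \<open>(x, z)\<close> are global polynomial
  coordinates on the moduli space (\<open>nijenhuis_eq\<close>).  Only a few structure constants enter, and
  these agree in the printed and in the corrected table.

  The BiHom-Lie axioms hold for \<open>L2\<close> and \<open>L3_corrected a\<close> because both are twists
  \<open>{\<alpha> x, \<beta> y}\<close> of one Lie bracket by commuting Lie algebra endomorphisms
  (\<open>bihom_lie_algebra_twist\<close>).  The endomorphisms all belong to a single one-parameter group
  \<open>unipotent a\<close>, with \<open>(\<alpha>, \<beta>)\<close> at parameters \<open>(0, 1)\<close> and \<open>(1, a)\<close> respectively.
\<close>

section \<open>Triangular Toeplitz matrices\<close>

definition toeplitz :: "complex \<Rightarrow> complex \<Rightarrow> complex \<Rightarrow> complex^3^3" where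
  "toeplitz x y z = mat3 [[x, y, z], [0, x, y], [0, 0, x]]"

text \<open>This is the binomial series for the \<open>a\<close>-th power of the Jordan block \<open>1 + E\<close>.\<close>

definition unipotent :: "complex \<Rightarrow> complex^3^3" where
  "unipotent a = toeplitz 1 a ((a^2 - a) / 2)"

lemma mat3_nth [simp]:
  "mat3 [r1, r2, r3] $ 1 = vector r1"
  "mat3 [r1, r2, r3] $ 2 = vector r2"
  "mat3 [r1, r2, r3] $ 3 = vector r3"
  by (simp_all add: mat3_def)

lemma table3_nth [simp]:
  "table3 [m1, m2, m3] $ 1 = mat3 m1"
  "table3 [m1, m2, m3] $ 2 = mat3 m2"
  "table3 [m1, m2, m3] $ 3 = mat3 m3"
  by (simp_all add: table3_def)

lemma toeplitz_mult_vec_nth [simp]: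
  "(toeplitz x y z *v v) $ 1 = x * v $ 1 + y * v $ 2 + z * v $ 3"
  "(toeplitz x y z *v v) $ 2 = x * v $ 2 + y * v $ 3"
  "(toeplitz x y z *v v) $ 3 = x * v $ 3"
  by (simp_all add: toeplitz_def matrix_vector_mult_def sum_3)

lemma toeplitz_commute:
  "(*v) (toeplitz x y z) \<circ> (*v) (toeplitz x' y' z')
     = (*v) (toeplitz x' y' z') \<circ> (*v) (toeplitz x y z)"
  by (simp add: fun_eq_iff vec_eq_iff forall_3 algebra_simps)

lemma unipotent_0: "(*v) (unipotent 0) = id"
  by (simp add: fun_eq_iff vec_eq_iff forall_3 unipotent_def)

lemma clinear_matrix_vector_mult: "clinear ((*v) (A :: complex^'n^'m))"
  by (rule matrix_vector_mul_linear_gen)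

lemma commutes_with_unipotent_one:
  assumes "clinear N" and comm: "N \<circ> (*v) (unipotent 1) = (*v) (unipotent 1) \<circ> N"
  obtains x y z where "N = (*v) (toeplitz x y z)"
proof -
  define A where "A = matrix N"
  have N: "N = (*v) A"
    using assms(1) by (simp add: A_def fun_eq_iff matrix_works)
  have "A *v (unipotent 1 *v v) = unipotent 1 *v (A *v v)" for v
    using comm by (simp add: N fun_eq_iff)
  from this[of "axis 1 1"] this[of "axis 2 1"] this[of "axis 3 1"]
  have "A = toeplitz (A$1$1) (A$1$2) (A$1$3)"
    by (simp add: vec_eq_iff forall_3 unipotent_def toeplitz_def matrix_vector_mult_def
        sum_3 axis_def)
  then show thesis using N that by metis
qed

section \<open>Brackets given by structure constants\<close>

lemma bracket_of_nth:
  "bracket_of c x y $ k =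
     x$1 * y$1 * c$1$1$k + x$1 * y$2 * c$1$2$k + x$1 * y$3 * c$1$3$k
   + x$2 * y$1 * c$2$1$k + x$2 * y$2 * c$2$2$k + x$2 * y$3 * c$2$3$k
   + x$3 * y$1 * c$3$1$k + x$3 * y$2 * c$3$2$k + x$3 * y$3 * c$3$3$k"
  by (simp add: bracket_of_def sum_3)

lemma clinear_bracket_of_right: "clinear (bracket_of c x)"
  by unfold_locales (simp_all add: vec_eq_iff bracket_of_nth algebra_simps)

lemma clinear_bracket_of_left: "clinear (\<lambda>x. bracket_of c x y)"
  by unfold_locales (simp_all add: vec_eq_iff bracket_of_nth algebra_simps)

section \<open>Nijenhuis operators on algebras twisted by a Jordan block\<close>

text \<open>The hypotheses on \<open>c\<close> say that \<open>[e\<^sub>1, e\<^sub>1] = 0\<close>, that no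
  bracket with \<open>e\<^sub>1\<close> has an \<open>e\<^sub>3\<close>-component, and that \<open>[e\<^sub>2, e\<^sub>1]\<close> and \<open>[e\<^sub>2, e\<^sub>2]\<close> are multiples of \<open>e\<^sub>1\<close>.  Under
  these, the \<open>e\<^sub>1\<close>-component of the Nijenhuis identity for \<open>x + y E + z E\<^sup>2\<close> at \<open>(e\<^sub>2, e\<^sub>3)\<close> reduces to a
  multiple of \<open>y\<^sup>2\<close>, and \<open>obstruction\<close> is the condition that this multiple is not zero.\<close>

locale jordan_twisted =
  fixes L :: "3 bihom" and c :: "complex^3^3^3" and s t :: complex
  assumes br: "br L = bracket_of c"
    and twa: "twa L = (*v) (unipotent s)" and twb: "twb L = (*v) (unipotent t)"
    and jordan: "s = 1 \<or> t = 1"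
    and e1_e1: "c$1$1 = 0"
    and e1_no_e3: "c$1$2$3 = 0" "c$1$3$3 = 0" "c$2$1$3 = 0" "c$3$1$3 = 0"
    and into_e1: "c$2$2$2 = 0" "c$2$2$3 = 0" "c$2$1$2 = 0"
    and obstruction: "c$1$2$1 - c$1$3$2 + c$2$3$3 \<noteq> 0"
begin

lemma commutant:
  assumes "clinear N" "N \<circ> twa L = twa L \<circ> N" "N \<circ> twb L = twb L \<circ> N"
  obtains x y z where "N = (*v) (toeplitz x y z)"
  using commutes_with_unipotent_one assms jordan unfolding twa twb by metis

lemma toeplitz_in_nijenhuis: "(*v) (toeplitz x 0 z) \<in> nijenhuis L"
proof -
  let ?N = "(*v) (toeplitz x 0 z)"
  have "br L (?N u) (?N v) = ?N (br L (?N u) v + br L u (?N v) - ?N (br L u v))" for u v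
    using e1_e1 e1_no_e3
    by (simp add: br vec_eq_iff forall_3 bracket_of_nth) (simp add: algebra_simps)
  moreover have "?N \<circ> (*v) (unipotent r) = (*v) (unipotent r) \<circ> ?N" for r
    unfolding unipotent_def by (rule toeplitz_commute)
  ultimately show ?thesis
    by (simp add: nijenhuis_def clinear_matrix_vector_mult twa twb)
qed

lemma nijenhuis_imp_toeplitz:
  assumes "N \<in> nijenhuis L"
  obtains x z where "N = (*v) (toeplitz x 0 z)"
proof -
  from assms have "clinear N" "N \<circ> twa L = twa L \<circ> N" "N \<circ> twb L = twb L \<circ> N"
    and nij: "br L (N u) (N v) = N (br L (N u) v + br L u (N v) - N (br L u v))" for u v
    by (auto simp: nijenhuis_def)
  then obtain x y z where N: "N = (*v) (toeplitz x y z)" using commutant by metis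
  have "br L (N (axis 2 1)) (N (axis 3 1)) $ 1
      = N (br L (N (axis 2 1)) (axis 3 1) + br L (axis 2 1) (N (axis 3 1))
           - N (br L (axis 2 1) (axis 3 1))) $ 1"
    by (simp only: nij)
  then have "y^2 * c$1$2$1 + y^2 * c$2$3$3 = y^2 * c$1$3$2"
    using e1_e1 e1_no_e3 into_e1
    by (simp add: br N bracket_of_nth axis_def) (simp add: algebra_simps power2_eq_square)
  then have "y^2 * (c$1$2$1 - c$1$3$2 + c$2$3$3) = 0" by algebra
  then have "y = 0" using obstruction by simp
  then show thesis using N that by metis
qed

lemma nijenhuis_eq: "nijenhuis L = range (\<lambda>p :: complex^2. (*v) (toeplitz (p$1) 0 (p$2)))"
proof -
  have "N \<in> range (\<lambda>p :: complex^2. (*v) (toeplitz (p$1) 0 (p$2)))" if "N \<in> nijenhuis L" for N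
  proof -
    obtain x z where "N = (*v) (toeplitz x 0 z)" using nijenhuis_imp_toeplitz \<open>N \<in> nijenhuis L\<close> .
    then show ?thesis by (intro range_eqI[of _ _ "vector [x, z]"]) simp
  qed
  then show ?thesis using toeplitz_in_nijenhuis by (intro equalityI subsetI) auto
qed

text \<open>Automorphisms commute with the twisting maps as well, so they too are Toeplitz and fix
  every Nijenhuis operator under conjugation.\<close>

lemma conjugacy_trivial: "conjugacy L = Id_on (nijenhuis L)"
proof -
  have "\<phi> \<circ> N \<circ> inv \<phi> = N" if N: "N \<in> nijenhuis L" and \<phi>: "\<phi> \<in> automorphisms L" for N \<phi>
  proof -
    obtain x z where Neq: "N = (*v) (toeplitz x 0 z)" using nijenhuis_imp_toeplitz N by metis
    have "clinear \<phi>" "\<phi> \<circ> twa L = twa L \<circ> \<phi>" "\<phi> \<circ> twb L = twb L \<circ> \<phi>" and "bij \<phi>"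
      using \<phi> by (auto simp: automorphisms_def)
    then obtain u v w where "\<phi> = (*v) (toeplitz u v w)" using commutant by metis
    then have "\<phi> \<circ> N = N \<circ> \<phi>" using Neq toeplitz_commute by metis
    then show ?thesis
      using \<open>bij \<phi>\<close> by (simp add: o_assoc[symmetric] bij_is_surj surj_iff[THEN iffD1])
  qed
  moreover have "id \<in> automorphisms L"
    using clinear_matrix_vector_mult[of "unipotent 0"] by (simp add: automorphisms_def unipotent_0)
  moreover have "N = id \<circ> N \<circ> inv id" for N :: "complex^3 \<Rightarrow> complex^3" by simp
  ultimately have "(N, N') \<in> conjugacy L \<longleftrightarrow> N \<in> nijenhuis L \<and> N' = N" for N N'
    unfolding conjugacy_def mem_Collect_eq case_prod_conv by metis
  then show ?thesis by (auto simp: Id_on_def)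
qed

theorem moduli_identification_exists:
  "\<exists>\<Phi> :: (complex^3 \<Rightarrow> complex^3) set \<Rightarrow> complex^2. moduli_identification L \<Phi>"
proof -
  define \<sigma> :: "complex^2 \<Rightarrow> complex^3 \<Rightarrow> complex^3"
    where "\<sigma> p = (*v) (toeplitz (p$1) 0 (p$2))" for p
  define coords :: "(complex^3 \<Rightarrow> complex^3) \<Rightarrow> complex^2"
    where "coords N = vector [matrix N $ 1 $ 1, matrix N $ 1 $ 3]" for N
  define \<Phi> where "\<Phi> X = coords (the_elem X)" for X
  have nij: "nijenhuis L = range \<sigma>" using nijenhuis_eq by (simp add: \<sigma>_def)
  have mat\<sigma>: "matrix (\<sigma> p) = toeplitz (p$1) 0 (p$2)" for p
    by (simp add: \<sigma>_def matrix_of_matrix_vector_mul)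
  have coords\<sigma>: "coords (\<sigma> p) = p" for p
    by (simp add: coords_def mat\<sigma> toeplitz_def vec_eq_iff forall_2)
  have cls: "conjugacy L `` {\<sigma> p} = {\<sigma> p}" for p
    by (auto simp: conjugacy_trivial nij)
  have \<Phi>\<sigma>: "\<Phi> (conjugacy L `` {\<sigma> p}) = p" for p
    by (simp add: cls \<Phi>_def coords\<sigma>)
  have "moduli_space L = range (\<lambda>p. conjugacy L `` {\<sigma> p})"
    by (auto simp: moduli_space_def quotient_def nij)
  then have bij: "bij_betw \<Phi> (moduli_space L) UNIV"
    by (intro bij_betw_byWitness[where f' = "\<lambda>p. conjugacy L `` {\<sigma> p}"]) (auto simp: \<Phi>\<sigma>)
  have "\<exists>f. polynomial_in operator_coords f \<and>
      (\<forall>N\<in>nijenhuis L. \<Phi> (conjugacy L `` {N}) $ k = f N)" for k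
  proof -
    have "polynomial_in operator_coords (\<lambda>N. matrix N $ i $ j)" for i j :: 3
      by (rule polynomial_in.coord) (auto simp: operator_coords_def)
    then have "polynomial_in operator_coords (\<lambda>N. coords N $ k)"
      using exhaust_2[of k] by (auto simp: coords_def)
    then show ?thesis by (auto simp: nij \<Phi>\<sigma> coords\<sigma>)
  qed
  moreover have "polynomial_in vector_coords (\<lambda>p. matrix (\<sigma> p) $ i $ j)" for i j
  proof -
    have "polynomial_in vector_coords (\<lambda>p :: complex^2. p $ k)" for k
      by (auto simp: vector_coords_def intro: polynomial_in.coord)
    then show ?thesis
      using exhaust_3[of i] exhaust_3[of j]
      by (elim disjE) (simp_all add: mat\<sigma> toeplitz_def polynomial_in.const)
  qed
  moreover have "\<sigma> p \<in> nijenhuis L" for p by (simp add: nij)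
  ultimately have "moduli_identification L \<Phi>"
    unfolding moduli_identification_def
    using bij \<Phi>\<sigma> by (intro conjI exI[of _ \<sigma>] allI) simp_all
  then show ?thesis by (rule exI[of _ \<Phi>])
qed

end

section \<open>BiHom-Lie algebras as twists of Lie algebras\<close>

text \<open>The twisted bracket turns the BiHom axioms into the Lie axioms: skew-symmetry is applied to
  \<open>\<alpha>\<beta> x\<close> and \<open>\<alpha>\<beta> y\<close>, and the Jacobi identity to \<open>\<alpha>\<beta>\<^sup>2 x\<close>, \<open>\<alpha>\<beta>\<^sup>2 y\<close> and \<open>\<alpha>\<beta>\<^sup>2 z\<close>.\<close>

lemma bihom_lie_algebra_twist:
  fixes L :: "'n::finite bihom" and lie :: "complex^'n \<Rightarrow> complex^'n \<Rightarrow> complex^'n"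
  assumes lin: "\<And>x. clinear (lie x)" "\<And>y. clinear (\<lambda>x. lie x y)"
    and skew: "\<And>x y. lie x y = - lie y x"
    and jacobi: "\<And>x y z. lie x (lie y z) + lie y (lie z x) + lie z (lie x y) = 0"
    and twa: "clinear (twa L)" "\<And>x y. twa L (lie x y) = lie (twa L x) (twa L y)"
    and twb: "clinear (twb L)" "\<And>x y. twb L (lie x y) = lie (twb L x) (twb L y)"
    and comm: "twa L \<circ> twb L = twb L \<circ> twa L"
    and br: "\<And>x y. br L x y = lie (twa L x) (twb L y)"
  shows "bihom_lie_algebra L"
proof -
  have ab: "twa L (twb L x) = twb L (twa L x)" for x
    using comm by (simp add: fun_eq_iff)
  have "br L x = lie (twa L x) \<circ> twb L" for x
    by (simp add: fun_eq_iff br)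
  then have "clinear (br L x)" for x
    using Vector_Spaces.linear_compose[OF twb(1) lin(1)] by simp
  moreover have "clinear (\<lambda>x. br L x y)" for y
    using Vector_Spaces.linear_compose[OF twa(1) lin(2)] by (simp add: br o_def)
  ultimately show ?thesis
    unfolding bihom_lie_algebra_def
    using twa(1) twb(1) comm by (auto simp: br twa(2) twb(2) ab jacobi intro: skew)
qed

definition lie_bracket :: "complex^3 \<Rightarrow> complex^3 \<Rightarrow> complex^3" where
  "lie_bracket = bracket_of (table3
     [[[0, 0, 0],  [2, 0, 0],  [-1, 2, 0]],
      [[-2, 0, 0], [0, 0, 0],  [1, 1, 2]],
      [[1, -2, 0], [-1, -1, -2], [0, 0, 0]]])"

lemma lie_bracket_nth [simp]:
  "lie_bracket x y $ 1 = 2 * (x$1 * y$2 - x$2 * y$1) - (x$1 * y$3 - x$3 * y$1)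
     + (x$2 * y$3 - x$3 * y$2)"
  "lie_bracket x y $ 2 = 2 * (x$1 * y$3 - x$3 * y$1) + (x$2 * y$3 - x$3 * y$2)"
  "lie_bracket x y $ 3 = 2 * (x$2 * y$3 - x$3 * y$2)"
  by (simp_all add: lie_bracket_def bracket_of_nth algebra_simps)

lemma lie_bracket_skew: "lie_bracket x y = - lie_bracket y x"
  by (simp add: vec_eq_iff forall_3 algebra_simps)

lemma lie_bracket_jacobi:
  "lie_bracket x (lie_bracket y z) + lie_bracket y (lie_bracket z x)
     + lie_bracket z (lie_bracket x y) = 0"
  unfolding vec_eq_iff forall_3 lie_bracket_nth vector_add_component zero_index
  by (intro conjI; algebra)

lemma unipotent_lie_bracket:
  "unipotent a *v lie_bracket x y = lie_bracket (unipotent a *v x) (unipotent a *v y)"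
  unfolding vec_eq_iff forall_3 lie_bracket_nth toeplitz_mult_vec_nth unipotent_def
  by (intro conjI; simp add: field_simps power2_eq_square)

lemma bihom_lie_algebra_unipotent_twist:
  assumes "twa L = (*v) (unipotent s)" "twb L = (*v) (unipotent t)"
    and "\<And>x y. br L x y = lie_bracket (unipotent s *v x) (unipotent t *v y)"
  shows "bihom_lie_algebra L"
proof (rule bihom_lie_algebra_twist[where lie = lie_bracket])
  show "clinear (lie_bracket x)" "clinear (\<lambda>x. lie_bracket x y)" for x y
    unfolding lie_bracket_def
    by (rule clinear_bracket_of_right, rule clinear_bracket_of_left)
  show "twa L \<circ> twb L = twb L \<circ> twa L"
    unfolding assms unipotent_def by (rule toeplitz_commute)
qed (simp_all only: assms unipotent_lie_bracket clinear_matrix_vector_mult lie_bracket_jacobi,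
     rule lie_bracket_skew)

section \<open>The three families\<close>

lemma unipotent_1: "mat3 [[1, 1, 0], [0, 1, 1], [0, 0, 1]] = unipotent 1"
  by (simp add: unipotent_def toeplitz_def)

lemma L3_data_twists:
  "br (L3_data a c) = bracket_of c"
  "twa (L3_data a c) = (*v) (unipotent 1)"
  "twb (L3_data a c) = (*v) (unipotent a)"
  by (simp_all add: L3_data_def unipotent_1) (simp add: unipotent_def toeplitz_def)

lemma L2_twists: "twa L2 = (*v) (unipotent 0)" "twb L2 = (*v) (unipotent 1)"
  by (simp_all add: L2_def unipotent_0 unipotent_1)

lemmas br_L2 = arg_cong[OF L2_def, of br, unfolded bihom.select_convs]

lemma bihom_lie_algebra_L2: "bihom_lie_algebra L2"
proof (rule bihom_lie_algebra_unipotent_twist[OF L2_twists])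
  fix x y
  show "br L2 x y = lie_bracket (unipotent 0 *v x) (unipotent 1 *v y)"
    unfolding br_L2 vec_eq_iff forall_3 bracket_of_nth lie_bracket_nth unipotent_def
      toeplitz_mult_vec_nth table3_nth mat3_nth vector_3
    by (intro conjI; simp; algebra)
qed

lemma bihom_lie_algebra_L3_corrected: "bihom_lie_algebra (L3_corrected a)"
  unfolding L3_corrected_def
proof (rule bihom_lie_algebra_unipotent_twist[OF L3_data_twists(2,3)])
  fix x y
  show "br (L3_data a (table3
     [[[0, 0, 0],  [2, 0, 0],  [2*a - 1, 2, 0]],
      [[-2, 0, 0], [2*(1 - a), 0, 0],  [3*a - a^2, 3, 2]],
      [[-1, -2, 0], [-(a + 1), -(1 + 2*a), -2],
         [(1 - a)*(a + 2) / 2, 1 - a^2, 2*(1 - a)]]])) x y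
    = lie_bracket (unipotent 1 *v x) (unipotent a *v y)"
    unfolding L3_data_twists vec_eq_iff forall_3 bracket_of_nth lie_bracket_nth unipotent_def
      toeplitz_mult_vec_nth table3_nth mat3_nth vector_3
    by (intro conjI; simp add: field_simps power2_eq_square)
qed

lemma moduli_L2:
  "\<exists>\<Phi> :: (complex^3 \<Rightarrow> complex^3) set \<Rightarrow> complex^2. moduli_identification L2 \<Phi>"
  by (rule jordan_twisted.moduli_identification_exists,
      rule jordan_twisted.intro[OF br_L2 L2_twists])
     (simp_all add: vec_eq_iff forall_3)

lemma moduli_L3:
  "\<exists>\<Phi> :: (complex^3 \<Rightarrow> complex^3) set \<Rightarrow> complex^2. moduli_identification (L3 a) \<Phi>"
  unfolding L3_def
  by (rule jordan_twisted.moduli_identification_exists,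
      rule jordan_twisted.intro[OF L3_data_twists])
     (simp_all add: vec_eq_iff forall_3)

lemma moduli_L3_corrected:
  "\<exists>\<Phi> :: (complex^3 \<Rightarrow> complex^3) set \<Rightarrow> complex^2. moduli_identification (L3_corrected a) \<Phi>"
  unfolding L3_corrected_def
  by (rule jordan_twisted.moduli_identification_exists,
      rule jordan_twisted.intro[OF L3_data_twists])
     (simp_all add: vec_eq_iff forall_3)

theorem theorem11p2:
  shows "(bihom_lie_algebra L2 \<and>
            (\<exists>\<Phi> :: (complex^3 \<Rightarrow> complex^3) set \<Rightarrow> complex^2. moduli_identification L2 \<Phi>)) \<and>
         (\<forall>a. \<exists>\<Phi> :: (complex^3 \<Rightarrow> complex^3) set \<Rightarrow> complex^2. moduli_identification (L3 a) \<Phi>) \<and>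
         (\<forall>a. bihom_lie_algebra (L3_corrected a) \<and>
            (\<exists>\<Phi> :: (complex^3 \<Rightarrow> complex^3) set \<Rightarrow> complex^2.
               moduli_identification (L3_corrected a) \<Phi>))"
  by (intro conjI allI bihom_lie_algebra_L2 bihom_lie_algebra_L3_corrected
      moduli_L2 moduli_L3 moduli_L3_corrected)

end
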